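(* For every double Boolean algebra $\mathbf D$, the topological spaces $(\mathcal F_{pr}(\mathbf D),\mathcal T)$ and $(\mathcal I_{pr}(\mathbf D),\mathcal J)$ are compact and totally disconnected; hence both are Hausdorff.
   Context: A double Boolean algebra (dBa) is an algebra $\mathbf{D}=(D,\sqcup,\sqcap,\neg,\lrcorner,\top,\bot)$ of type $(2,2,1,1,0,0)$ such that, with $x\vee y:=\neg(\neg x\sqcap\neg y)$ and $x\wedge y:=\lrcorner(\lrcorner x\sqcup\lrcorner y)$, for all $x,y,z\in D$: $(x\sqcap x)\sqcap y=x\sqcap y$; $x\sqcap y=y\sqcap x$; $x\sqcap(y\sqcap z)=(x\sqcap y)\sqcap z$; $\neg(x\sqcap x)=\neg x$; $x\sqcap(x\sqcup y)=x\sqcap x$; $x\sqcap(y\vee z)=(x\sqcap y)\vee(x\sqcap z)$; $x\sqcap(x\vee y)=x\sqcap x$; $\neg\neg(x\sqcap y)=x\sqcap y$; $x\sqcap\neg x=\bot$; $\neg\bot=\top\sqcap\top$; $\neg\top=\bot$; the duals $(x\sqcup x)\sqcup y=x\sqcup y$; $x\sqcup y=y\sqcup x$; $x\sqcup(y\sqcup z)=(x\sqcup y)\sqcup z$; $\lrcorner(x\sqcup x)=\lrcorner x$; $x\sqcup(x\sqcap y)=x\sqcup x$; $x\sqcup(y\wedge z)=(x\sqcup y)\wedge(x\sqcup z)$; $x\sqcup(x\wedge y)=x\sqcup x$; $\lrcorner\lrcorner(x\sqcup y)=x\sqcup y$; $x\sqcup\lrcorner x=\top$; $\lrcorner\top=\bot\sqcup\bot$;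 $\lrcorner\bot=\top$; and $(x\sqcap x)\sqcup(x\sqcap x)=(x\sqcup x)\sqcap(x\sqcup x)$. The quasi-order is $x\sqsubseteq y$ iff $x\sqcap y=x\sqcap x$ and $x\sqcup y=y\sqcup y$. A filter is $F\subseteq D$ closed under $\sqcap$ and upward closed for $\sqsubseteq$; an ideal is $I\subseteq D$ closed under $\sqcup$ and downward closed. A primary filter is a filter $F\ne D$ with $x\in F$ or $\neg x\in F$ for all $x$; a primary ideal is an ideal $I\ne D$ with $x\in I$ or $\lrcorner x\in I$ for all $x$. $\mathcal F_{pr}(\mathbf D)$, $\mathcal I_{pr}(\mathbf D)$ are the sets of primary filters and ideals; $F_x:=\{F\in\mathcal F_{pr}(\mathbf D):x\in F\}$, $I_x:=\{I\in\mathcal I_{pr}(\mathbf D):x\in I\}$. $\mathcal T$ is the topology on $\mathcal F_{pr}(\mathbf D)$ having $\{F_x:x\in D\}$ as a subbase of closed sets, and $\mathcal J$ the topology on $\mathcal I_{pr}(\mathbf D)$ having $\{I_x:x\in D\}$ as a subbase of closed sets. A space is totally disconnected if any two distinct points are separated by a clopen set. *)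

theory Defs
  imports "HOL-Analysis.Analysis" "HOL-Algebra.Congruence"
begin

record 'a dba = "'a partial_object" +
  djoin :: "['a, 'a] \<Rightarrow> 'a" (infixl \<open>\<squnion>\<index>\<close> 65)
  dmeet :: "['a, 'a] \<Rightarrow> 'a" (infixl \<open>\<sqinter>\<index>\<close> 70)
  dneg :: "'a \<Rightarrow> 'a" (\<open>\<^bold>\<not>\<index> _\<close> [81] 80)
  dopp :: "'a \<Rightarrow> 'a" (\<open>\<^bold>\<rfloor>\<index> _\<close> [81] 80)
  dtop :: 'a (\<open>\<top>\<index>\<close>)
  dbot :: 'a (\<open>\<bottom>\<index>\<close>)

definition dvee :: "[('a, 'm) dba_scheme, 'a, 'a] \<Rightarrow> 'a" (infixl \<open>\<^bold>\<or>\<index>\<close> 65)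
  where "x \<^bold>\<or>\<^bsub>D\<^esub> y = \<^bold>\<not>\<^bsub>D\<^esub> (\<^bold>\<not>\<^bsub>D\<^esub> x \<sqinter>\<^bsub>D\<^esub> \<^bold>\<not>\<^bsub>D\<^esub> y)"

definition dwedge :: "[('a, 'm) dba_scheme, 'a, 'a] \<Rightarrow> 'a" (infixl \<open>\<^bold>\<and>\<index>\<close> 70)
  where "x \<^bold>\<and>\<^bsub>D\<^esub> y = \<^bold>\<rfloor>\<^bsub>D\<^esub> (\<^bold>\<rfloor>\<^bsub>D\<^esub> x \<squnion>\<^bsub>D\<^esub> \<^bold>\<rfloor>\<^bsub>D\<^esub> y)"

locale double_boolean_algebra =
  fixes D :: "('a, 'm) dba_scheme" (structure)
  assumes join_closed: "\<lbrakk>x \<in> carrier D; y \<in> carrier D\<rbrakk> \<Longrightarrow> x \<squnion> y \<in> carrier D"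
    and meet_closed: "\<lbrakk>x \<in> carrier D; y \<in> carrier D\<rbrakk> \<Longrightarrow> x \<sqinter> y \<in> carrier D"
    and neg_closed: "x \<in> carrier D \<Longrightarrow> \<^bold>\<not> x \<in> carrier D"
    and opp_closed: "x \<in> carrier D \<Longrightarrow> \<^bold>\<rfloor> x \<in> carrier D"
    and top_closed: "\<top> \<in> carrier D"
    and bot_closed: "\<bottom> \<in> carrier D"
    and meet_idem_left: "\<lbrakk>x \<in> carrier D; y \<in> carrier D\<rbrakk> \<Longrightarrow> (x \<sqinter> x) \<sqinter> y = x \<sqinter> y"
    and meet_comm: "\<lbrakk>x \<in> carrier D; y \<in> carrier D\<rbrakk> \<Longrightarrow> x \<sqinter> y = y \<sqinter> x"
    and meet_assoc: "\<lbrakk>x \<in> carrier D; y \<in> carrier D; z \<in> carrier D\<rbrakk> \<Longrightarrow>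
          x \<sqinter> (y \<sqinter> z) = (x \<sqinter> y) \<sqinter> z"
    and neg_meet_idem: "x \<in> carrier D \<Longrightarrow> \<^bold>\<not> (x \<sqinter> x) = \<^bold>\<not> x"
    and meet_join_absorb: "\<lbrakk>x \<in> carrier D; y \<in> carrier D\<rbrakk> \<Longrightarrow> x \<sqinter> (x \<squnion> y) = x \<sqinter> x"
    and meet_vee_distrib: "\<lbrakk>x \<in> carrier D; y \<in> carrier D; z \<in> carrier D\<rbrakk> \<Longrightarrow>
          x \<sqinter> (y \<^bold>\<or> z) = (x \<sqinter> y) \<^bold>\<or> (x \<sqinter> z)"
    and meet_vee_absorb: "\<lbrakk>x \<in> carrier D; y \<in> carrier D\<rbrakk> \<Longrightarrow> x \<sqinter> (x \<^bold>\<or> y) = x \<sqinter> x"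
    and neg_neg_meet: "\<lbrakk>x \<in> carrier D; y \<in> carrier D\<rbrakk> \<Longrightarrow> \<^bold>\<not> (\<^bold>\<not> (x \<sqinter> y)) = x \<sqinter> y"
    and meet_neg: "x \<in> carrier D \<Longrightarrow> x \<sqinter> \<^bold>\<not> x = \<bottom>"
    and neg_bot: "\<^bold>\<not> \<bottom> = \<top> \<sqinter> \<top>"
    and neg_top: "\<^bold>\<not> \<top> = \<bottom>"
    and join_idem_left: "\<lbrakk>x \<in> carrier D; y \<in> carrier D\<rbrakk> \<Longrightarrow> (x \<squnion> x) \<squnion> y = x \<squnion> y"
    and join_comm: "\<lbrakk>x \<in> carrier D; y \<in> carrier D\<rbrakk> \<Longrightarrow> x \<squnion> y = y \<squnion> x"
    and join_assoc: "\<lbrakk>x \<in> carrier D; y \<in> carrier D; z \<in> carrier D\<rbrakk> \<Longrightarrow>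
          x \<squnion> (y \<squnion> z) = (x \<squnion> y) \<squnion> z"
    and opp_join_idem: "x \<in> carrier D \<Longrightarrow> \<^bold>\<rfloor> (x \<squnion> x) = \<^bold>\<rfloor> x"
    and join_meet_absorb: "\<lbrakk>x \<in> carrier D; y \<in> carrier D\<rbrakk> \<Longrightarrow> x \<squnion> (x \<sqinter> y) = x \<squnion> x"
    and join_wedge_distrib: "\<lbrakk>x \<in> carrier D; y \<in> carrier D; z \<in> carrier D\<rbrakk> \<Longrightarrow>
          x \<squnion> (y \<^bold>\<and> z) = (x \<squnion> y) \<^bold>\<and> (x \<squnion> z)"
    and join_wedge_absorb: "\<lbrakk>x \<in> carrier D; y \<in> carrier D\<rbrakk> \<Longrightarrow> x \<squnion> (x \<^bold>\<and> y) = x \<squnion> x"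
    and opp_opp_join: "\<lbrakk>x \<in> carrier D; y \<in> carrier D\<rbrakk> \<Longrightarrow> \<^bold>\<rfloor> (\<^bold>\<rfloor> (x \<squnion> y)) = x \<squnion> y"
    and join_opp: "x \<in> carrier D \<Longrightarrow> x \<squnion> \<^bold>\<rfloor> x = \<top>"
    and opp_top: "\<^bold>\<rfloor> \<top> = \<bottom> \<squnion> \<bottom>"
    and opp_bot: "\<^bold>\<rfloor> \<bottom> = \<top>"
    and meet_join_idem: "x \<in> carrier D \<Longrightarrow>
          (x \<sqinter> x) \<squnion> (x \<sqinter> x) = (x \<squnion> x) \<sqinter> (x \<squnion> x)"

definition dle :: "[('a, 'm) dba_scheme, 'a, 'a] \<Rightarrow> bool" (infix \<open>\<sqsubseteq>\<index>\<close> 50)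
  where "x \<sqsubseteq>\<^bsub>D\<^esub> y \<longleftrightarrow> x \<sqinter>\<^bsub>D\<^esub> y = x \<sqinter>\<^bsub>D\<^esub> x \<and> x \<squnion>\<^bsub>D\<^esub> y = y \<squnion>\<^bsub>D\<^esub> y"

definition dba_filter :: "('a, 'm) dba_scheme \<Rightarrow> 'a set \<Rightarrow> bool"
  where "dba_filter D F \<longleftrightarrow> F \<subseteq> carrier D \<and>
    (\<forall>x\<in>F. \<forall>y\<in>F. x \<sqinter>\<^bsub>D\<^esub> y \<in> F) \<and>
    (\<forall>x\<in>F. \<forall>y\<in>carrier D. x \<sqsubseteq>\<^bsub>D\<^esub> y \<longrightarrow> y \<in> F)"

definition dba_ideal :: "('a, 'm) dba_scheme \<Rightarrow> 'a set \<Rightarrow> bool"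
  where "dba_ideal D I \<longleftrightarrow> I \<subseteq> carrier D \<and>
    (\<forall>x\<in>I. \<forall>y\<in>I. x \<squnion>\<^bsub>D\<^esub> y \<in> I) \<and>
    (\<forall>x\<in>I. \<forall>y\<in>carrier D. y \<sqsubseteq>\<^bsub>D\<^esub> x \<longrightarrow> y \<in> I)"

definition primary_filters :: "('a, 'm) dba_scheme \<Rightarrow> 'a set set"
  where "primary_filters D =
    {F. dba_filter D F \<and> F \<noteq> carrier D \<and> (\<forall>x\<in>carrier D. x \<in> F \<or> \<^bold>\<not>\<^bsub>D\<^esub> x \<in> F)}"

definition primary_ideals :: "('a, 'm) dba_scheme \<Rightarrow> 'a set set"
  where "primary_ideals D =
    {I. dba_ideal D I \<and> I \<noteq> carrier D \<and> (\<forall>x\<in>carrier D. x \<in> I \<or> \<^bold>\<rfloor>\<^bsub>D\<^esub> x \<in> I)}"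

definition primary_filters_at :: "('a, 'm) dba_scheme \<Rightarrow> 'a \<Rightarrow> 'a set set"
  where "primary_filters_at D x = {F \<in> primary_filters D. x \<in> F}"

definition primary_ideals_at :: "('a, 'm) dba_scheme \<Rightarrow> 'a \<Rightarrow> 'a set set"
  where "primary_ideals_at D x = {I \<in> primary_ideals D. x \<in> I}"

text \<open>The coarsest topology on \<open>X\<close> in which every member of \<open>\<C>\<close> is closed. Taking finite
  intersections relative to \<open>X\<close> makes \<open>X\<close> the underlying set even if the complements do not
  cover it.\<close>

definition closed_subbase_topology :: "'b set \<Rightarrow> 'b set set \<Rightarrow> 'b topology"
  where "closed_subbase_topology X \<C> =
    topology (arbitrary union_of
      (finite intersection_of (\<lambda>U. U \<in> (\<lambda>C. X - C) ` \<C>) relative_to X))"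

lemma topspace_closed_subbase_topology: "topspace (closed_subbase_topology X \<C>) = X"
  unfolding closed_subbase_topology_def by (rule topspace_subbase)

lemma closedin_closed_subbase_topology:
  assumes "C \<in> \<C>" "C \<subseteq> X"
  shows "closedin (closed_subbase_topology X \<C>) C"
proof -
  have "(finite intersection_of (\<lambda>U. U \<in> (\<lambda>C. X - C) ` \<C>) relative_to X) (X \<inter> (X - C))"
    using assms(1) by (intro relative_to_inc finite_intersection_of_inc) auto
  then have "openin (closed_subbase_topology X \<C>) (X \<inter> (X - C))"
    unfolding closed_subbase_topology_def openin_subbase by (rule arbitrary_union_of_inc)
  then show ?thesis
    using assms(2)
    by (simp add: closedin_def topspace_closed_subbase_topology Int_absorb1 Diff_subset)
qed

definition primary_filter_space :: "('a, 'm) dba_scheme \<Rightarrow> 'a set topology"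
  where "primary_filter_space D =
    closed_subbase_topology (primary_filters D) (primary_filters_at D ` carrier D)"

definition primary_ideal_space :: "('a, 'm) dba_scheme \<Rightarrow> 'a set topology"
  where "primary_ideal_space D =
    closed_subbase_topology (primary_ideals D) (primary_ideals_at D ` carrier D)"

text \<open>Separation of points by clopen sets; some authors call this totally separated.\<close>

definition totally_disconnected_space :: "'b topology \<Rightarrow> bool"
  where "totally_disconnected_space X \<longleftrightarrow>
    (\<forall>x\<in>topspace X. \<forall>y\<in>topspace X. x \<noteq> y \<longrightarrow>
      (\<exists>U. openin X U \<and> closedin X U \<and> x \<in> U \<and> y \<notin> U))"

end

theory Submission
  imports Defs
begin

text \<open>
  Since \<open>\<bottom>\<close> lies below every element, a filter is proper iff it omits \<open>\<bottom>\<close>. Hence being a primary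
  filter is a conjunction of conditions each involving only finitely many elements, so the primary
  filters form a closed subset of the Cantor space of all subsets of the carrier, and Tychonoff's
  theorem gives compactness without any appeal to a prime filter theorem. A primary filter contains
  exactly one of \<open>x\<close> and \<open>\<not> x\<close>, so the subbasic closed sets are clopen and separate points.
  The ideals of an algebra are the filters of its order dual.
\<close>

lemma continuous_map_into_closed_subbase_topology:
  assumes f: "f \<in> topspace T \<rightarrow> X"
    and closed: "\<And>C. C \<in> \<C> \<Longrightarrow> closedin T {x \<in> topspace T. f x \<in> C}"
  shows "continuous_map T (closed_subbase_topology X \<C>) f"
  unfolding closed_subbase_topology_def
proof (rule continuous_map_into_topology_subbase)
  show "f x \<in> topspace (topology (arbitrary union_of
      (finite intersection_of (\<lambda>U. U \<in> (\<lambda>C. X - C) ` \<C>) relative_to X)))"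
    if "x \<in> topspace T" for x
    using f that by (auto simp only: topspace_subbase)
  fix U assume "U \<in> (\<lambda>C. X - C) ` \<C>"
  then obtain C where "C \<in> \<C>" and U: "U = X - C" by blast
  moreover have "{x \<in> topspace T. f x \<in> U} = topspace T - {x \<in> topspace T. f x \<in> C}"
    using f U by auto
  ultimately show "openin T {x \<in> topspace T. f x \<in> U}"
    using closed by (simp add: openin_diff)
qed

lemma compact_space_closed_subbase_topology_image:
  assumes "compact_space T" and surj: "f ` topspace T = X"
    and closed: "\<And>C. C \<in> \<C> \<Longrightarrow> closedin T {x \<in> topspace T. f x \<in> C}"
  shows "compact_space (closed_subbase_topology X \<C>)"
proof -
  have "f \<in> topspace T \<rightarrow> X"
    using surj by blast
  then have "continuous_map T (closed_subbase_topology X \<C>) f"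
    using closed by (rule continuous_map_into_closed_subbase_topology)
  then have "compactin (closed_subbase_topology X \<C>) (f ` topspace T)"
    using \<open>compact_space T\<close> image_compactin unfolding compact_space_def by blast
  then show ?thesis
    by (simp add: surj compact_space_def topspace_closed_subbase_topology)
qed

lemma closedin_Collect_conj:
  assumes "closedin X {x \<in> topspace X. P x}" "closedin X {x \<in> topspace X. Q x}"
  shows "closedin X {x \<in> topspace X. P x \<and> Q x}"
proof -
  have "{x \<in> topspace X. P x \<and> Q x} = {x \<in> topspace X. P x} \<inter> {x \<in> topspace X. Q x}"
    by blast
  then show ?thesis
    using assms by (simp add: closedin_Int)
qed

lemma closedin_Collect_disj:
  assumes "closedin X {x \<in> topspace X. P x}" "closedin X {x \<in> topspace X. Q x}"
  shows "closedin X {x \<in> topspace X. P x \<or> Q x}"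
proof -
  have "{x \<in> topspace X. P x \<or> Q x} = {x \<in> topspace X. P x} \<union> {x \<in> topspace X. Q x}"
    by blast
  then show ?thesis
    using assms by (simp add: closedin_Un)
qed

lemma closedin_Collect_ball:
  assumes "\<And>i. i \<in> I \<Longrightarrow> closedin X {x \<in> topspace X. P i x}"
  shows "closedin X {x \<in> topspace X. \<forall>i\<in>I. P i x}"
proof (cases "I = {}")
  case False
  then have "{x \<in> topspace X. \<forall>i\<in>I. P i x} = (\<Inter>i\<in>I. {x \<in> topspace X. P i x})"
    by blast
  then show ?thesis
    using assms False by (simp add: closedin_INT)
qed simp

definition cantor_topology :: "'a set \<Rightarrow> 'a set topology"
  where "cantor_topology A = closed_subbase_topology (Pow A)
    ((\<lambda>x. {F \<in> Pow A. x \<in> F}) ` A \<union> (\<lambda>x. {F \<in> Pow A. x \<notin> F}) ` A)"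

lemma topspace_cantor_topology [simp]: "topspace (cantor_topology A) = Pow A"
  by (simp add: cantor_topology_def topspace_closed_subbase_topology)

lemma closedin_cantor_topology_mem:
  assumes "x \<in> A"
  shows "closedin (cantor_topology A) {F \<in> topspace (cantor_topology A). x \<in> F}"
  unfolding topspace_cantor_topology unfolding cantor_topology_def using assms
  by (intro closedin_closed_subbase_topology) auto

lemma closedin_cantor_topology_not_mem:
  assumes "x \<in> A"
  shows "closedin (cantor_topology A) {F \<in> topspace (cantor_topology A). x \<notin> F}"
  unfolding topspace_cantor_topology unfolding cantor_topology_def using assms
  by (intro closedin_closed_subbase_topology) auto

lemma compact_space_cantor_topology: "compact_space (cantor_topology A)"
proof -
  define T where "T = product_topology (\<lambda>_. discrete_topology (UNIV :: bool set)) A"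
  have topspace: "topspace T = A \<rightarrow>\<^sub>E UNIV"
    by (simp add: T_def)
  have coordinate: "closedin T {f \<in> topspace T. f x \<in> B}" if "x \<in> A" for x B
    unfolding T_def using that
    by (intro closedin_continuous_map_preimage [OF continuous_map_product_projection]) auto
  have "compact_space T"
    by (simp add: T_def compact_space_product_topology compact_space_discrete_topology)
  then show ?thesis
    unfolding cantor_topology_def
  proof (rule compact_space_closed_subbase_topology_image [where f = "\<lambda>f. {x \<in> A. f x}"])
    have "F \<in> (\<lambda>f. {x \<in> A. f x}) ` topspace T" if "F \<in> Pow A" for F
      using that by (intro image_eqI [where x = "\<lambda>x\<in>A. x \<in> F"]) (auto simp: topspace)
    then show "(\<lambda>f. {x \<in> A. f x}) ` topspace T = Pow A"
      by blast
  next
    fix C assume "C \<in> (\<lambda>x. {F \<in> Pow A. x \<in> F}) ` A \<union> (\<lambda>x. {F \<in> Pow A. x \<notin> F}) ` A"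
    then show "closedin T {f \<in> topspace T. {x \<in> A. f x} \<in> C}"
      using coordinate [where B = "{True}"] coordinate [where B = "{False}"]
      by (auto cong: conj_cong)
  qed
qed

definition membership_topology :: "'a set \<Rightarrow> 'a set set \<Rightarrow> 'a set topology"
  where "membership_topology A X = closed_subbase_topology X ((\<lambda>x. {F \<in> X. x \<in> F}) ` A)"

lemma topspace_membership_topology [simp]: "topspace (membership_topology A X) = X"
  by (simp add: membership_topology_def topspace_closed_subbase_topology)

lemma closedin_membership_topology:
  assumes "x \<in> A"
  shows "closedin (membership_topology A X) {F \<in> X. x \<in> F}"
  unfolding membership_topology_def using assms
  by (intro closedin_closed_subbase_topology) auto

lemma compact_space_membership_topology:
  assumes "closedin (cantor_topology A) X"
  shows "compact_space (membership_topology A X)"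
  unfolding membership_topology_def
proof (rule compact_space_closed_subbase_topology_image [where f = "\<lambda>F. F"])
  have X: "X \<subseteq> Pow A"
    using closedin_subset [OF assms] by simp
  show "compact_space (subtopology (cantor_topology A) X)"
    using assms closedin_compact_space compact_space_cantor_topology compact_space_subtopology
    by blast
  show "(\<lambda>F. F) ` topspace (subtopology (cantor_topology A) X) = X"
    using X by auto
  fix C assume "C \<in> (\<lambda>x. {F \<in> X. x \<in> F}) ` A"
  then obtain x where "x \<in> A" "C = {F \<in> X. x \<in> F}" by blast
  moreover have "{F \<in> topspace (subtopology (cantor_topology A) X). F \<in> {F \<in> X. x \<in> F}}
      = X \<inter> {F \<in> topspace (cantor_topology A). x \<in> F}"
    by auto
  ultimately show "closedin (subtopology (cantor_topology A) X)
      {F \<in> topspace (subtopology (cantor_topology A) X). F \<in> C}"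
    using closedin_cantor_topology_mem closedin_subtopology_Int_closed by metis
qed

lemma totally_disconnected_space_membership_topology:
  assumes X: "X \<subseteq> Pow A"
    and compl: "\<And>x. x \<in> A \<Longrightarrow> \<exists>x'\<in>A. \<forall>F\<in>X. x' \<in> F \<longleftrightarrow> x \<notin> F"
  shows "totally_disconnected_space (membership_topology A X)"
  unfolding totally_disconnected_space_def
proof (intro ballI impI)
  fix F G
  assume "F \<in> topspace (membership_topology A X)" "G \<in> topspace (membership_topology A X)"
  then have FG: "F \<in> X" "G \<in> X" by simp_all
  assume "F \<noteq> G"
  then obtain y where "y \<in> A" "y \<in> F \<longleftrightarrow> y \<notin> G"
    using FG X by blast
  then obtain x where x: "x \<in> A" "x \<in> F" "x \<notin> G"
    using FG compl by metis
  obtain x' where "x' \<in> A" and x': "\<forall>F\<in>X. x' \<in> F \<longleftrightarrow> x \<notin> F"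
    using compl x(1) by blast
  then have "openin (membership_topology A X)
      (topspace (membership_topology A X) - {F \<in> X. x' \<in> F})"
    by (intro openin_diff openin_topspace closedin_membership_topology)
  also have "topspace (membership_topology A X) - {F \<in> X. x' \<in> F} = {F \<in> X. x \<in> F}"
    using x' by auto
  finally have "openin (membership_topology A X) {F \<in> X. x \<in> F}" .
  then show "\<exists>U. openin (membership_topology A X) U \<and> closedin (membership_topology A X) U \<and>
      F \<in> U \<and> G \<notin> U"
    using closedin_membership_topology [OF x(1)] x FG by blast
qed

lemma totally_disconnected_imp_Hausdorff_space:
  assumes "totally_disconnected_space X"
  shows "Hausdorff_space X"
  unfolding Hausdorff_space_def
proof (intro allI impI)
  fix x y assume "x \<in> topspace X \<and> y \<in> topspace X \<and> x \<noteq> y"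
  then obtain U where "openin X U" "closedin X U" "x \<in> U" "y \<notin> U" "y \<in> topspace X"
    using assms unfolding totally_disconnected_space_def by blast
  then show "\<exists>U V. openin X U \<and> openin X V \<and> x \<in> U \<and> y \<in> V \<and> disjnt U V"
    by (intro exI [of _ U] exI [of _ "topspace X - U"]) (auto simp: disjnt_def)
qed

lemma primary_filter_space_eq_membership_topology:
  "primary_filter_space D = membership_topology (carrier D) (primary_filters D)"
  by (simp add: primary_filter_space_def membership_topology_def primary_filters_at_def [abs_def])

lemma primary_ideal_space_eq_membership_topology:
  "primary_ideal_space D = membership_topology (carrier D) (primary_ideals D)"
  by (simp add: primary_ideal_space_def membership_topology_def primary_ideals_at_def [abs_def])

context double_boolean_algebra
begin

lemma bot_meet:
  assumes "x \<in> carrier D"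
  shows "\<bottom> \<sqinter> x = \<bottom>"
proof -
  have "\<bottom> \<sqinter> x = x \<sqinter> (x \<sqinter> \<^bold>\<not> x)"
    using assms by (simp add: meet_neg meet_comm bot_closed)
  also have "\<dots> = x \<sqinter> \<^bold>\<not> x"
    using assms by (simp add: meet_assoc meet_idem_left neg_closed)
  finally show ?thesis
    using assms by (simp add: meet_neg)
qed

lemma bot_join:
  assumes "x \<in> carrier D"
  shows "\<bottom> \<squnion> x = x \<squnion> x"
proof -
  have "\<bottom> \<squnion> x = x \<squnion> (x \<sqinter> \<^bold>\<not> x)"
    using assms by (simp add: meet_neg join_comm bot_closed)
  then show ?thesis
    using assms by (simp add: join_meet_absorb neg_closed)
qed

lemma bot_dle: "x \<in> carrier D \<Longrightarrow> \<bottom> \<sqsubseteq> x"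
  by (simp add: dle_def bot_meet bot_join bot_closed)

lemma dba_filter_proper_iff:
  assumes "dba_filter D F"
  shows "F \<noteq> carrier D \<longleftrightarrow> \<bottom> \<notin> F"
proof -
  have "F \<subseteq> carrier D" "\<And>y. \<bottom> \<in> F \<Longrightarrow> y \<in> carrier D \<Longrightarrow> y \<in> F"
    using assms bot_dle unfolding dba_filter_def by blast+
  then show ?thesis
    using bot_closed by blast
qed

lemma primary_filters_eq_bot_notin:
  "primary_filters D =
    {F. dba_filter D F \<and> \<bottom> \<notin> F \<and> (\<forall>x\<in>carrier D. x \<in> F \<or> \<^bold>\<not> x \<in> F)}"
  unfolding primary_filters_def using dba_filter_proper_iff by blast

lemma primary_filters_subset: "primary_filters D \<subseteq> Pow (carrier D)"
  by (auto simp: primary_filters_def dba_filter_def)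

lemma neg_mem_primary_filter_iff:
  assumes "F \<in> primary_filters D" and "x \<in> carrier D"
  shows "\<^bold>\<not> x \<in> F \<longleftrightarrow> x \<notin> F"
proof -
  have "x \<sqinter> \<^bold>\<not> x \<in> F" if "x \<in> F" "\<^bold>\<not> x \<in> F"
    using assms that by (auto simp: primary_filters_eq_bot_notin dba_filter_def)
  then show ?thesis
    using assms by (auto simp: primary_filters_eq_bot_notin meet_neg)
qed

lemma closedin_primary_filters: "closedin (cantor_topology (carrier D)) (primary_filters D)"
proof -
  let ?T = "cantor_topology (carrier D)"
  have "primary_filters D = {F \<in> topspace ?T.
      (\<forall>x\<in>carrier D. \<forall>y\<in>carrier D. x \<notin> F \<or> y \<notin> F \<or> x \<sqinter> y \<in> F) \<and>
      (\<forall>x\<in>carrier D. \<forall>y\<in>{y \<in> carrier D. x \<sqsubseteq> y}. x \<notin> F \<or> y \<in> F) \<and>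
      \<bottom> \<notin> F \<and> (\<forall>x\<in>carrier D. x \<in> F \<or> \<^bold>\<not> x \<in> F)}"
    unfolding primary_filters_eq_bot_notin dba_filter_def topspace_cantor_topology by blast
  also have "closedin ?T \<dots>"
    by (intro closedin_Collect_conj closedin_Collect_disj closedin_Collect_ball
        closedin_cantor_topology_mem closedin_cantor_topology_not_mem)
      (auto simp: bot_closed meet_closed neg_closed)
  finally show ?thesis .
qed

lemma compact_space_primary_filter_space: "compact_space (primary_filter_space D)"
  unfolding primary_filter_space_eq_membership_topology
  by (rule compact_space_membership_topology [OF closedin_primary_filters])

lemma totally_disconnected_space_primary_filter_space:
  "totally_disconnected_space (primary_filter_space D)"
  unfolding primary_filter_space_eq_membership_topology
  using primary_filters_subset neg_mem_primary_filter_iff neg_closed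
  by (intro totally_disconnected_space_membership_topology) blast+

end

definition dual_dba :: "('a, 'm) dba_scheme \<Rightarrow> 'a dba"
  where "dual_dba D = \<lparr>carrier = carrier D, djoin = dmeet D, dmeet = djoin D,
    dneg = dopp D, dopp = dneg D, dtop = dbot D, dbot = dtop D\<rparr>"

lemma dual_dba_simps [simp]:
  "carrier (dual_dba D) = carrier D"
  "djoin (dual_dba D) = dmeet D"
  "dmeet (dual_dba D) = djoin D"
  "dneg (dual_dba D) = dopp D"
  "dopp (dual_dba D) = dneg D"
  "dtop (dual_dba D) = dbot D"
  "dbot (dual_dba D) = dtop D"
  "dvee (dual_dba D) = dwedge D"
  "dwedge (dual_dba D) = dvee D"
  by (simp_all add: dual_dba_def dvee_def dwedge_def fun_eq_iff)

context double_boolean_algebra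
begin

lemma double_boolean_algebra_dual: "double_boolean_algebra (dual_dba D)"
  by (unfold_locales, unfold dual_dba_simps)
    (fact join_closed meet_closed neg_closed opp_closed top_closed bot_closed
      join_idem_left join_comm join_assoc opp_join_idem join_meet_absorb join_wedge_distrib
      join_wedge_absorb opp_opp_join join_opp opp_top opp_bot
      meet_idem_left meet_comm meet_assoc neg_meet_idem meet_join_absorb meet_vee_distrib
      meet_vee_absorb neg_neg_meet meet_neg neg_bot neg_top meet_join_idem [symmetric])+

lemma dle_dual_iff:
  assumes "x \<in> carrier D" "y \<in> carrier D"
  shows "x \<sqsubseteq>\<^bsub>dual_dba D\<^esub> y \<longleftrightarrow> y \<sqsubseteq> x"
  using assms by (auto simp: dle_def join_comm meet_comm)

lemma dba_filter_dual_iff: "dba_filter (dual_dba D) I \<longleftrightarrow> dba_ideal D I"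
  unfolding dba_filter_def dba_ideal_def dual_dba_simps using dle_dual_iff by blast

lemma primary_filters_dual: "primary_filters (dual_dba D) = primary_ideals D"
  by (simp add: primary_filters_def primary_ideals_def dba_filter_dual_iff)

lemma primary_filter_space_dual: "primary_filter_space (dual_dba D) = primary_ideal_space D"
  by (simp add: primary_filter_space_eq_membership_topology
      primary_ideal_space_eq_membership_topology primary_filters_dual)

end

theorem mainTheorem17:
  fixes D :: "('a, 'm) dba_scheme"
  assumes "double_boolean_algebra D"
  shows "compact_space (primary_filter_space D) \<and>
         totally_disconnected_space (primary_filter_space D) \<and>
         Hausdorff_space (primary_filter_space D) \<and>
         compact_space (primary_ideal_space D) \<and>
         totally_disconnected_space (primary_ideal_space D) \<and>
         Hausdorff_space (primary_ideal_space D)"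
proof -
  interpret double_boolean_algebra D by fact
  interpret dual: double_boolean_algebra "dual_dba D"
    by (rule double_boolean_algebra_dual)
  have "compact_space (primary_ideal_space D)" "totally_disconnected_space (primary_ideal_space D)"
    using dual.compact_space_primary_filter_space
      dual.totally_disconnected_space_primary_filter_space
    by (simp_all add: primary_filter_space_dual)
  then show ?thesis
    using compact_space_primary_filter_space totally_disconnected_space_primary_filter_space
    by (simp add: totally_disconnected_imp_Hausdorff_space)
qed

end
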